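(* Let $G$ be a graph and let $\mathcal{P} = \{V_1, \ldots, V_r\}$ be a partition of $V(G)$, where $r \ge 2$. Suppose that (a) $G$ is block-minimal with no IT (with respect to $\mathcal{P}$), (b) $G$ is the disjoint union of complete bipartite graphs, and (c) the number of components of $G$ is $r - 1$. Then there exist a component $K_{A,B}$ of $G$ and two distinct blocks $V_i, V_j$ in $\mathcal{P}$ such that $A \subseteq V_i$ and $B \subseteq V_j$.
   Context: Graphs are finite and simple. For a graph $G$ and a partition $\mathcal{P} = \{V_1, \ldots, V_r\}$ of $V(G)$ into (nonempty) blocks, an independent transversal (IT) of $G$ with respect to $\mathcal{P}$ is an independent set $\{v_1, \ldots, v_r\}$ of $G$ with $v_i \in V_i$ for every $i$. $G$ is block-minimal with no IT (with respect to $\mathcal{P}$) if $G$ has no IT with respect to $\mathcal{P}$ but $G - V_i$ has an IT with respect to $\mathcal{P} \setminus \{V_i\}$ for every $i \in \{1,\ldots,r\}$. $K_{A,B}$ denotes the complete bipartite graph with (nonempty) parts $A$ and $B$. *)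

theory Defs
  imports "Graph_Theory.Graph_Theory" "HOL-Library.Disjoint_Sets"
begin

text \<open>
  Finite simple graphs are rendered by the locale \<^locale>\<open>graph\<close>: finite symmetric digraphs
  without loops and without parallel arcs.  The connected components of such a graph are its
  strongly connected components \<^const>\<open>pre_digraph.sccs\<close>.
\<close>

definition independent_set :: "('a, 'b) pre_digraph \<Rightarrow> 'a set \<Rightarrow> bool" where
  "independent_set G S \<longleftrightarrow> S \<subseteq> verts G \<and> (\<forall>u\<in>S. \<forall>v\<in>S. \<not> u \<rightarrow>\<^bsub>G\<^esub> v)"

definition independent_transversal ::
    "('a, 'b) pre_digraph \<Rightarrow> 'a set set \<Rightarrow> 'a set \<Rightarrow> bool" where
  "independent_transversal G P S \<longleftrightarrow>
     independent_set G S \<and> (\<exists>v. (\<forall>V\<in>P. v V \<in> V) \<and> S = v ` P)"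

definition block_minimal_no_IT :: "('a, 'b) pre_digraph \<Rightarrow> 'a set set \<Rightarrow> bool" where
  "block_minimal_no_IT G P \<longleftrightarrow>
     \<not> (\<exists>S. independent_transversal G P S) \<and>
     (\<forall>V\<in>P. \<exists>S. independent_transversal (G \<restriction> (verts G - V)) (P - {V}) S)"

text \<open>
  \<^const>\<open>complete_bipartite_digraph\<close> records only the sizes of the two parts and allows them to be
  empty; here the parts themselves are needed, and they are nonempty.
\<close>

definition complete_bipartite_on :: "'a set \<Rightarrow> 'a set \<Rightarrow> ('a, 'b) pre_digraph \<Rightarrow> bool" where
  "complete_bipartite_on A B H \<longleftrightarrow>
     graph H \<and> A \<noteq> {} \<and> B \<noteq> {} \<and> A \<inter> B = {} \<and>
     verts H = A \<union> B \<and> arcs_ends H = A \<times> B \<union> B \<times> A"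

lemma complete_bipartite_on_imp_complete_bipartite_digraph:
  "complete_bipartite_on A B H \<Longrightarrow> complete_bipartite_digraph (card A) (card B) H"
  unfolding complete_bipartite_on_def complete_bipartite_digraph_def by blast

text \<open>
  \<^const>\<open>pre_digraph.Union\<close> takes its tail and head functions from its first argument; requiring
  the members of \<open>Hs\<close> to be subgraphs of \<open>G\<close> makes their tail and head functions agree with it.
\<close>

definition disjoint_union_of_complete_bipartite :: "('a, 'b) pre_digraph \<Rightarrow> bool" where
  "disjoint_union_of_complete_bipartite G \<longleftrightarrow>
     (\<exists>Hs. (\<forall>H\<in>Hs. subgraph H G \<and> (\<exists>A B. complete_bipartite_on A B H)) \<and>
           pairwise (\<lambda>H K. verts H \<inter> verts K = {}) Hs \<and>
           G = pre_digraph.Union G Hs)"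

end

theory Submission
  imports Defs
begin

text \<open>
  An independent set meets each component in at most one of its two parts, so an independent
  transversal amounts to choosing one part of each component such that every block meets a chosen
  part.  Reading components as Boolean variables and blocks as clauses, \<open>G\<close> becomes a minimally
  unsatisfiable CNF formula with one clause more than variables.  Hall's theorem shows that every
  proper subset of its clauses involves at least as many variables as it has clauses (Tarsi's
  lemma), and a closer look at the subsets attaining equality shows that every clause contains a
  literal occurring in no other clause.  There being fewer variables than clauses, two of these
  literals share a variable, which then occurs exactly once positively and once negatively: this is
  a component each of whose parts lies in a single block.
\<close>

section \<open>Hall's marriage theorem\<close>

text \<open>Halmos-Vaughan induction: if some nonempty proper subset \<open>D\<close> attains
  equality, \<open>D\<close> and \<open>F - D\<close> are matched separately; otherwise every such
  subset has a spare neighbour, and one element can be matched arbitrarily.\<close>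

lemma marriage:
  fixes N :: "'c \<Rightarrow> 'v set"
  assumes "finite F" and "\<And>c. c \<in> F \<Longrightarrow> finite (N c)"
    and "\<And>D. D \<subseteq> F \<Longrightarrow> card D \<le> card (\<Union> (N ` D))"
  shows "\<exists>f. inj_on f F \<and> (\<forall>c\<in>F. f c \<in> N c)"
  using assms
proof (induction "card F" arbitrary: F N rule: less_induct)
  case less
  note fin = less.prems(1) and finN = less.prems(2) and hall = less.prems(3)
  show ?case
  proof (cases "\<exists>D. D \<noteq> {} \<and> D \<subset> F \<and> card D = card (\<Union> (N ` D))")
    case True
    then obtain D where D: "D \<noteq> {}" "D \<subset> F" "card D = card (\<Union> (N ` D))" by blast
    define M where "M c = N c - \<Union> (N ` D)" for c
    have finD: "finite D" using D(2) fin finite_subset by blast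
    have "F - D \<subset> F" using D(1,2) by blast
    then have lt: "card D < card F" "card (F - D) < card F"
      using D(2) fin by (auto intro: psubset_card_mono)
    have "\<exists>f. inj_on f D \<and> (\<forall>c\<in>D. f c \<in> N c)"
    proof (rule less.hyps[OF lt(1) finD])
      show "finite (N c)" if "c \<in> D" for c using that D(2) by (intro finN) blast
      show "card E \<le> card (\<Union> (N ` E))" if "E \<subseteq> D" for E using that D(2) by (intro hall) blast
    qed
    then obtain f where f: "inj_on f D" "\<forall>c\<in>D. f c \<in> N c" by blast
    \<comment> \<open>Hall's condition survives the removal of the neighbours of \<open>D\<close>:
      apply it to \<open>D \<union> E\<close> and cancel the equality for \<open>D\<close>.\<close>
    have "card E \<le> card (\<Union> (M ` E))" if E: "E \<subseteq> F - D" for E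
    proof -
      have finE: "finite E" using E fin finite_subset by blast
      have "card D + card E = card (D \<union> E)"
        using E finD finE by (subst card_Un_disjoint) auto
      also have "\<dots> \<le> card (\<Union> (N ` (D \<union> E)))"
        using D(2) E by (intro hall) auto
      also have "\<Union> (N ` (D \<union> E)) = \<Union> (N ` D) \<union> \<Union> (M ` E)"
        unfolding M_def by auto
      also have "card \<dots> \<le> card (\<Union> (N ` D)) + card (\<Union> (M ` E))" by (rule card_Un_le)
      finally show ?thesis using D(3) by simp
    qed
    then have "\<exists>g. inj_on g (F - D) \<and> (\<forall>c\<in>F - D. g c \<in> M c)"
      by (intro less.hyps lt) (auto intro: finN fin simp: M_def)
    then obtain g where g: "inj_on g (F - D)" "\<forall>c\<in>F - D. g c \<in> M c" by blast
    define h where "h c = (if c \<in> D then f c else g c)" for c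
    have "inj_on h F"
    proof (rule inj_onI)
      fix a b assume ab: "a \<in> F" "b \<in> F" "h a = h b"
      have "f c \<in> \<Union> (N ` D)" if "c \<in> D" for c using f(2) that by blast
      moreover have "g c \<notin> \<Union> (N ` D)" if "c \<in> F - D" for c
        using g(2) that unfolding M_def by blast
      ultimately have "a \<in> D \<longleftrightarrow> b \<in> D" using ab unfolding h_def by (metis DiffI)
      then show "a = b"
        using ab f(1) g(1) unfolding h_def by (auto split: if_splits dest: inj_onD)
    qed
    moreover have "\<forall>c\<in>F. h c \<in> N c"
      using f(2) g(2) unfolding h_def M_def by auto
    ultimately show ?thesis by blast
  next
    case False
    show ?thesis
    proof (cases "F = {}")
      case False
      then obtain c where c: "c \<in> F" by blast
      have "card {c} \<le> card (\<Union> (N ` {c}))" using c by (intro hall) auto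
      then have "N c \<noteq> {}" by auto
      then obtain x where x: "x \<in> N c" by blast
      have "card E \<le> card (\<Union> ((\<lambda>d. N d - {x}) ` E))" if E: "E \<subseteq> F - {c}" for E
      proof (cases "E = {}")
        case False
        have "card E \<le> card (\<Union> (N ` E))" using E by (intro hall) auto
        \<comment> \<open>Equality is excluded in this case, so the loss of \<open>x\<close> is
          affordable.\<close>
        moreover have "card E \<noteq> card (\<Union> (N ` E))"
          using \<open>\<not> (\<exists>D. D \<noteq> {} \<and> D \<subset> F \<and> card D = card (\<Union> (N ` D)))\<close> False E c by blast
        moreover have "card (\<Union> (N ` E)) - 1 \<le> card (\<Union> (N ` E) - {x})"
          by (metis card_Diff_singleton_if diff_le_self order_refl)
        moreover have "\<Union> ((\<lambda>d. N d - {x}) ` E) = \<Union> (N ` E) - {x}" by auto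
        ultimately show ?thesis by simp
      qed simp
      moreover have "card (F - {c}) < card F" using c fin by (rule card_Diff1_less[rotated])
      ultimately have "\<exists>g. inj_on g (F - {c}) \<and> (\<forall>d\<in>F - {c}. g d \<in> N d - {x})"
        by (intro less.hyps) (auto intro: fin finN)
      then obtain g where g: "inj_on g (F - {c})" "\<forall>d\<in>F - {c}. g d \<in> N d - {x}" by blast
      have "inj_on (g(c := x)) F"
        using g by (auto simp: inj_on_def)
      moreover have "\<forall>d\<in>F. (g(c := x)) d \<in> N d" using g(2) x by auto
      ultimately show ?thesis by blast
    qed simp
  qed
qed

section \<open>Formulas and extensions of assignments\<close>

text \<open>Clauses are indices into \<open>L\<close>, so subformulas are just subsets, and clauses
  with equal literal sets are still counted separately. A literal pairs a variable with the value
  that makes it true.\<close>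

definition vars :: "('c \<Rightarrow> ('v \<times> bool) set) \<Rightarrow> 'c set \<Rightarrow> 'v set" where
  "vars L D = (\<Union>c\<in>D. fst ` L c)"

definition satisfies :: "('c \<Rightarrow> ('v \<times> bool) set) \<Rightarrow> ('v \<Rightarrow> bool) \<Rightarrow> 'c set \<Rightarrow> bool" where
  "satisfies L \<phi> D \<longleftrightarrow> (\<forall>c\<in>D. \<exists>x. (x, \<phi> x) \<in> L c)"

lemma vars_Un: "vars L (D \<union> E) = vars L D \<union> vars L E"
  by (auto simp: vars_def)

lemma vars_mono: "D \<subseteq> E \<Longrightarrow> vars L D \<subseteq> vars L E"
  by (auto simp: vars_def)

lemma satisfies_cong:
  assumes "satisfies L \<phi> D" and "\<And>x. x \<in> vars L D \<Longrightarrow> \<psi> x = \<phi> x"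
  shows "satisfies L \<psi> D"
  unfolding satisfies_def
proof
  fix c assume c: "c \<in> D"
  then obtain x where x: "(x, \<phi> x) \<in> L c" using assms(1) unfolding satisfies_def by blast
  then have "x \<in> vars L D" using c unfolding vars_def by force
  then show "\<exists>x. (x, \<psi> x) \<in> L c" using x assms(2)[of x] by (intro exI[of _ x]) simp
qed

text \<open>Hall's theorem gives every clause of \<open>E\<close> a variable of its own outside
  \<open>W\<close>, which can be set to satisfy that clause without disturbing
  \<open>W\<close>.\<close>

lemma extend_assignment:
  assumes "finite E" and "\<And>c. c \<in> E \<Longrightarrow> finite (L c)"
    and "\<And>D. D \<subseteq> E \<Longrightarrow> card D \<le> card (vars L D - W)"
  obtains \<psi> where "\<And>x. x \<in> W \<Longrightarrow> \<psi> x = \<phi> x" and "satisfies L \<psi> E"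
proof -
  have "\<Union> ((\<lambda>c. fst ` L c - W) ` D) = vars L D - W" for D
    unfolding vars_def by auto
  then have "\<exists>f. inj_on f E \<and> (\<forall>c\<in>E. f c \<in> fst ` L c - W)"
    using assms by (intro marriage) auto
  then obtain f where f: "inj_on f E" "\<And>c. c \<in> E \<Longrightarrow> f c \<in> fst ` L c - W" by blast
  \<comment> \<open>If the positive literal of its own variable is absent from a clause, the
    negative one is present, so testing the positive one suffices.\<close>
  define \<psi> where
    "\<psi> x = (if x \<in> f ` E then (x, True) \<in> L (inv_into E f x) else \<phi> x)" for x
  show thesis
  proof
    fix x assume "x \<in> W"
    then show "\<psi> x = \<phi> x" using f(2) unfolding \<psi>_def by auto
  next
    have "(f c, \<psi> (f c)) \<in> L c" if c: "c \<in> E" for c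
    proof -
      have "\<psi> (f c) \<longleftrightarrow> (f c, True) \<in> L c" using c f(1) unfolding \<psi>_def by simp
      moreover obtain b where "(f c, b) \<in> L c" using f(2)[OF c] by auto
      ultimately show ?thesis by (cases b; cases "\<psi> (f c)") auto
    qed
    then show "satisfies L \<psi> E" unfolding satisfies_def by blast
  qed
qed

section \<open>Tarsi's lemma on deficiency\<close>

locale minimally_unsatisfiable =
  fixes L :: "'c \<Rightarrow> ('v \<times> bool) set" and F :: "'c set"
  assumes finite_clauses: "finite F"
    and finite_literals: "c \<in> F \<Longrightarrow> finite (L c)"
    and unsatisfiable: "\<not> satisfies L \<phi> F"
    and minimal: "c \<in> F \<Longrightarrow> \<exists>\<phi>. satisfies L \<phi> (F - {c})"
begin

lemma finite_subclauses: "D \<subseteq> F \<Longrightarrow> finite D"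
  using finite_clauses finite_subset by blast

lemma finite_vars: "D \<subseteq> F \<Longrightarrow> finite (vars L D)"
  unfolding vars_def using finite_literals finite_subclauses by blast

definition deficiency :: "'c set \<Rightarrow> int" where
  "deficiency D = int (card D) - int (card (vars L D))"

text \<open>Otherwise a proper subset \<open>M\<close> has the largest deficiency of all subsets. By
  minimality \<open>M\<close> is satisfiable, and by maximality Hall's condition lets the assignment
  extend to \<open>F\<close>.\<close>

lemma deficiency_proper_subset:
  assumes "D \<subset> F"
  shows "deficiency D < deficiency F"
proof (rule ccontr)
  assume not_less: "\<not> deficiency D < deficiency F"
  define S where "S = {D. D \<subset> F}"
  have "S \<subseteq> Pow F" unfolding S_def by blast
  then have finS: "finite S" using finite_clauses finite_subset by blast
  moreover have "S \<noteq> {}" using assms unfolding S_def by blast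
  ultimately obtain M where M: "M \<in> S" "deficiency M = Max (deficiency ` S)"
    using obtains_MAX[of S deficiency] by metis
  have MF: "M \<subset> F" using M(1) unfolding S_def by blast
  have max: "deficiency E \<le> deficiency M" if "E \<subseteq> F" for E
  proof -
    have le: "deficiency E \<le> deficiency M" if "E \<subset> F" for E
      using M(2) finS that unfolding S_def by simp
    show ?thesis using that le[of E] le[OF assms] not_less by (cases "E = F") auto
  qed
  obtain c where "c \<in> F" "c \<notin> M" using MF by blast
  then obtain \<phi> where "satisfies L \<phi> (F - {c})" using minimal by blast
  then have \<phi>: "satisfies L \<phi> M"
    using MF \<open>c \<notin> M\<close> unfolding satisfies_def by blast
  \<comment> \<open>Adding \<open>E\<close> to \<open>M\<close> cannot raise the deficiency, so
    \<open>E\<close> brings at least as many new variables as clauses.\<close>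
  have "card E \<le> card (vars L E - vars L M)" if E: "E \<subseteq> F - M" for E
  proof -
    have sub: "M \<subseteq> F" "E \<subseteq> F" using MF E by auto
    have "card (M \<union> E) = card M + card E"
      using E sub by (intro card_Un_disjoint finite_subclauses) auto
    moreover have "card (vars L (M \<union> E)) = card (vars L M) + card (vars L E - vars L M)"
      using sub by (simp add: vars_Un finite_vars card_Un_disjoint[symmetric])
    ultimately show ?thesis
      using max[of "M \<union> E"] sub unfolding deficiency_def by simp
  qed
  then obtain \<psi> where \<psi>: "\<And>x. x \<in> vars L M \<Longrightarrow> \<psi> x = \<phi> x" "satisfies L \<psi> (F - M)"
    using extend_assignment[of "F - M" L "vars L M" \<phi>] finite_clauses finite_literals
    by (metis Diff_iff finite_Diff)
  have "satisfies L \<psi> M" using \<phi> \<psi>(1) by (rule satisfies_cong)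
  then have "satisfies L \<psi> F" using \<psi>(2) unfolding satisfies_def by blast
  then show False using unsatisfiable by blast
qed

end

section \<open>Deficiency one: tight sets and private literals\<close>

text \<open>The assumption \<open>has_vars\<close> excludes the formula whose only clause is empty;
  it has deficiency one but no literal.\<close>

locale minimally_unsatisfiable_1 = minimally_unsatisfiable L F
  for L :: "'c \<Rightarrow> ('v \<times> bool) set" and F :: "'c set" +
  assumes deficiency_1: "card F = card (vars L F) + 1"
    and has_vars: "vars L F \<noteq> {}"
begin

lemma card_proper_le: "D \<subset> F \<Longrightarrow> card D \<le> card (vars L D)"
  using deficiency_proper_subset[of D] deficiency_1 unfolding deficiency_def by simp

definition tight :: "'c set \<Rightarrow> bool" where
  "tight D \<longleftrightarrow> D \<subset> F \<and> card D = card (vars L D)"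

text \<open>Counting clauses is modular and counting variables is submodular. As neither
  \<open>D \<union> E\<close> nor \<open>D \<inter> E\<close> may have positive deficiency, all
  inequalities become equalities. The condition on \<open>D \<union> E\<close> matters because
  \<open>F\<close> itself has deficiency one.\<close>

lemma tight_Un_Int:
  assumes "tight D" and "tight E" and "D \<union> E \<noteq> F"
  shows "tight (D \<union> E)" and "tight (D \<inter> E)" and "vars L (D \<inter> E) = vars L D \<inter> vars L E"
proof -
  have sub: "D \<subset> F" "E \<subset> F" "D \<union> E \<subset> F" "D \<inter> E \<subset> F"
    using assms unfolding tight_def by auto
  have fin: "finite D" "finite E" "finite (vars L D)" "finite (vars L E)"
    using sub by (auto intro: finite_subclauses finite_vars)
  have 1: "card (D \<union> E) + card (D \<inter> E) = card (vars L D) + card (vars L E)"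
    using fin assms card_Un_Int[of D E] unfolding tight_def by simp
  have 2: "card (vars L (D \<union> E)) + card (vars L D \<inter> vars L E) = card (vars L D) + card (vars L E)"
    using fin card_Un_Int[of "vars L D" "vars L E"] by (simp add: vars_Un)
  have le: "vars L (D \<inter> E) \<subseteq> vars L D \<inter> vars L E" by (simp add: vars_mono)
  then have 3: "card (vars L (D \<inter> E)) \<le> card (vars L D \<inter> vars L E)"
    using fin by (intro card_mono) auto
  have 4: "card (D \<union> E) \<le> card (vars L (D \<union> E))" "card (D \<inter> E) \<le> card (vars L (D \<inter> E))"
    using sub by (auto intro: card_proper_le)
  show "tight (D \<union> E)" "tight (D \<inter> E)"
    using 1 2 3 4 sub unfolding tight_def by auto
  show "vars L (D \<inter> E) = vars L D \<inter> vars L E"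
    using 1 2 3 4 fin le by (intro card_subset_eq) auto
qed

text \<open>
  Setting the variable \<open>x\<close> to \<open>b\<close> satisfies \<open>c\<close>, so the marriage condition must fail for the clauses
  that remain unsatisfied; a violating set is tight.
\<close>

lemma tight_without_literal:
  assumes "c \<in> F" and "(x, b) \<in> L c"
  obtains D where "tight D" and "x \<in> vars L D" and "\<And>d. d \<in> D \<Longrightarrow> (x, b) \<notin> L d"
proof -
  define E where "E = {d \<in> F. (x, b) \<notin> L d}"
  have EF: "E \<subset> F" using assms unfolding E_def by blast
  have "\<exists>D\<subseteq>E. \<not> card D \<le> card (vars L D - {x})"
  proof (rule ccontr)
    assume "\<not> ?thesis"
    then obtain \<psi> where \<psi>: "\<psi> x = b" "satisfies L \<psi> E"
      using extend_assignment[of E L "{x}" "\<lambda>_. b"] EF finite_clauses finite_literals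
      by (metis finite_subset insertI1 psubset_imp_subset subsetD)
    then have "satisfies L \<psi> F" unfolding satisfies_def E_def by blast
    then show False using unsatisfiable by blast
  qed
  then obtain D where D: "D \<subseteq> E" "card (vars L D - {x}) < card D" by auto
  have DF: "D \<subset> F" using D(1) EF by blast
  have le: "card D \<le> card (vars L D)" using DF by (rule card_proper_le)
  \<comment> \<open>Without \<open>x\<close> there are fewer variables than clauses, with all
    variables there are at least as many; so \<open>x\<close> is among them and makes up exactly the
    difference.\<close>
  have x: "x \<in> vars L D"
  proof (rule ccontr)
    assume "x \<notin> vars L D"
    then show False using D(2) le by simp
  qed
  then have "card (vars L D - {x}) = card (vars L D) - 1" by simp
  then have "tight D" using DF D(2) le unfolding tight_def by simp
  then show thesis using that x D(1) unfolding E_def by blast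
qed

text \<open>
  Tight sets are closed under intersection, so there is a least one involving \<open>x\<close>; it inherits the
  absence of a literal of \<open>c\<close> on \<open>x\<close>.
\<close>

lemma tight_hull:
  assumes "c \<in> F" and "x \<in> vars L {c}"
  obtains M where "tight M" and "c \<notin> M" and "x \<in> vars L M"
    and "\<And>D. tight D \<Longrightarrow> c \<notin> D \<Longrightarrow> x \<in> vars L D \<Longrightarrow> M \<subseteq> D"
    and "\<exists>b. (x, b) \<in> L c \<and> (\<forall>d\<in>M. (x, b) \<notin> L d)"
proof -
  obtain b where b: "(x, b) \<in> L c" using assms(2) unfolding vars_def by auto
  obtain T where T: "tight T" "x \<in> vars L T" "\<And>d. d \<in> T \<Longrightarrow> (x, b) \<notin> L d"
    using tight_without_literal[OF assms(1) b] by blast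
  let ?Q = "\<lambda>D. tight D \<and> c \<notin> D \<and> x \<in> vars L D"
  have "?Q T" using T b by blast
  then obtain M where M: "?Q M" "\<And>D. ?Q D \<Longrightarrow> card M \<le> card D"
    using ex_has_least_nat[of ?Q T card] by blast
  have sub: "M \<subseteq> D" if D: "?Q D" for D
  proof -
    \<comment> \<open>Both sets avoid \<open>c\<close>, which is what permits intersecting them;
      minimum cardinality then turns into leastness under inclusion.\<close>
    have "M \<union> D \<noteq> F" using M(1) D assms(1) by blast
    then have "?Q (M \<inter> D)" using tight_Un_Int[of M D] M(1) D by auto
    then have "card M \<le> card (M \<inter> D)" by (rule M(2))
    moreover have "finite M" using M(1) finite_subclauses unfolding tight_def by blast
    ultimately have "M \<inter> D = M" by (intro card_seteq) auto
    then show ?thesis by blast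
  qed
  then have "M \<subseteq> T" using \<open>?Q T\<close> by blast
  then show thesis using that[of M] M(1) sub b T(3) by blast
qed

text \<open>
  The hulls of the variables of \<open>c\<close> together exhaust the other clauses.  If \<open>x\<close> is a variable of \<open>c\<close>
  with largest hull and the literal missing from that hull occurs elsewhere, then it occurs in the
  hull of some \<open>y\<close>, which therefore contains, and by maximality equals, the hull of \<open>x\<close>.
\<close>

lemma unique_literal:
  assumes c: "c \<in> F"
  shows "\<exists>l\<in>L c. \<forall>d\<in>F. l \<in> L d \<longrightarrow> d = c"
proof (rule ccontr)
  assume "\<not> ?thesis"
  then have occurs: "\<exists>d\<in>F - {c}. l \<in> L d" if "l \<in> L c" for l using that by blast
  define X where "X = vars L {c}"
  have finX: "finite X" using c unfolding X_def by (intro finite_vars) simp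
  have "\<forall>x\<in>X. \<exists>M. tight M \<and> c \<notin> M \<and> x \<in> vars L M \<and>
      (\<forall>D. tight D \<longrightarrow> c \<notin> D \<longrightarrow> x \<in> vars L D \<longrightarrow> M \<subseteq> D) \<and>
      (\<exists>b. (x, b) \<in> L c \<and> (\<forall>d\<in>M. (x, b) \<notin> L d))" (is "\<forall>x\<in>X. \<exists>M. ?hull x M")
  proof
    fix x assume "x \<in> X"
    then have "x \<in> vars L {c}" unfolding X_def .
    from tight_hull[OF c this] obtain M where "tight M" "c \<notin> M" "x \<in> vars L M"
      "\<And>D. tight D \<Longrightarrow> c \<notin> D \<Longrightarrow> x \<in> vars L D \<Longrightarrow> M \<subseteq> D"
      "\<exists>b. (x, b) \<in> L c \<and> (\<forall>d\<in>M. (x, b) \<notin> L d)"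
      by blast
    then show "\<exists>M. ?hull x M" by (intro exI[of _ M]) simp
  qed
  from bchoice[OF this] obtain M where hull: "\<forall>x\<in>X. ?hull x (M x)" ..
  have M: "tight (M x)" "c \<notin> M x" "x \<in> vars L (M x)"
      "\<And>D. tight D \<Longrightarrow> c \<notin> D \<Longrightarrow> x \<in> vars L D \<Longrightarrow> M x \<subseteq> D"
      "\<exists>b. (x, b) \<in> L c \<and> (\<forall>d\<in>M x. (x, b) \<notin> L d)" if "x \<in> X" for x
    using bspec[OF hull that] by simp_all
  have tight_Union: "tight (\<Union> (M ` Y)) \<and> c \<notin> \<Union> (M ` Y)" if "Y \<subseteq> X" for Y
    using finite_subset[OF that finX] that
  proof (induction Y rule: finite_induct)
    case empty
    then show ?case using c unfolding tight_def vars_def by auto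
  next
    case (insert y Y)
    then have "M y \<union> \<Union> (M ` Y) \<noteq> F" using M(2) c by blast
    then show ?case using insert M(1,2) tight_Un_Int(1)[of "M y" "\<Union> (M ` Y)"] by auto
  qed
  define U where "U = \<Union> (M ` X)"
  have U: "tight U" "c \<notin> U" using tight_Union[of X] unfolding U_def by auto
  have "X \<subseteq> vars L U"
    using M(3) unfolding U_def vars_def by blast
  \<comment> \<open>Adding \<open>c\<close> to the tight set \<open>U\<close> adds a clause but no
    variable, which is impossible for a proper subset of \<open>F\<close>.\<close>
  then have "vars L (U \<union> {c}) = vars L U" unfolding vars_Un X_def by blast
  moreover have "finite U" using U(1) finite_subclauses unfolding tight_def by blast
  then have "card (U \<union> {c}) = card U + 1" using U(2) by simp
  ultimately have "\<not> U \<union> {c} \<subset> F"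
    using card_proper_le[of "U \<union> {c}"] U(1) unfolding tight_def by auto
  then have UF: "U = F - {c}" using U c unfolding tight_def by blast
  have "X \<noteq> {}"
  proof
    assume "X = {}"
    then have "F = {c}" using UF c unfolding U_def by auto
    then show False using has_vars \<open>X = {}\<close> unfolding X_def by simp
  qed
  then obtain x where x: "x \<in> X" "card (M x) = Max ((\<lambda>x. card (M x)) ` X)"
    using finX obtains_MAX[of X "\<lambda>x. card (M x)"] by metis
  then have max: "card (M y) \<le> card (M x)" if "y \<in> X" for y
    using finX that by simp
  obtain b where b: "(x, b) \<in> L c" "\<forall>d\<in>M x. (x, b) \<notin> L d" using M(5)[OF x(1)] by blast
  obtain d where d: "d \<in> U" "(x, b) \<in> L d" using occurs[OF b(1)] UF by blast
  then obtain y where y: "y \<in> X" "d \<in> M y" unfolding U_def by blast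
  have "x \<in> vars L (M y)" using y d unfolding vars_def by force
  then have "M x \<subseteq> M y" using M(1,2,4) x(1) y(1) by blast
  moreover have "finite (M y)" using M(1)[OF y(1)] finite_subclauses unfolding tight_def by blast
  ultimately have "M x = M y" using max[OF y(1)] by (intro card_seteq)
  then show False using b(2) d(2) y(2) by blast
qed

lemma variable_occurring_once_each:
  "\<exists>x\<in>vars L F. \<exists>c\<in>F. \<exists>d\<in>F. c \<noteq> d \<and>
     (\<forall>e\<in>F. (x, True) \<in> L e \<longrightarrow> e = c) \<and> (\<forall>e\<in>F. (x, False) \<in> L e \<longrightarrow> e = d)"
proof -
  obtain g where g: "\<And>c. c \<in> F \<Longrightarrow> g c \<in> L c"
      "\<And>c d. c \<in> F \<Longrightarrow> d \<in> F \<Longrightarrow> g c \<in> L d \<Longrightarrow> d = c"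
    using unique_literal by metis
  have "(fst \<circ> g) ` F \<subseteq> vars L F" using g(1) unfolding vars_def by auto
  then have "\<not> inj_on (fst \<circ> g) F"
    using deficiency_1 finite_vars card_inj_on_le[of "fst \<circ> g" F "vars L F"] by auto
  then obtain c d where cd: "c \<in> F" "d \<in> F" "c \<noteq> d" "fst (g c) = fst (g d)"
    unfolding inj_on_def by auto
  define x where "x = fst (g c)"
  have x: "x \<in> vars L F" using g(1) cd(1) unfolding x_def vars_def by blast
  have gc: "g c = (x, snd (g c))" and gd: "g d = (x, snd (g d))"
    unfolding x_def using cd(4) by (auto simp: prod_eq_iff)
  \<comment> \<open>A shared literal would be private to neither clause, so the two literals are the
    two signs of \<open>x\<close>.\<close>
  have "g c \<noteq> g d" using g(1)[OF cd(2)] g(2)[OF cd(1,2)] cd(3) by auto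
  then have "snd (g c) \<noteq> snd (g d)" using cd(4) by (simp add: prod_eq_iff)
  then consider "g c = (x, True)" "g d = (x, False)" | "g d = (x, True)" "g c = (x, False)"
    using gc gd by (cases "snd (g c)"; cases "snd (g d)") auto
  then show ?thesis
  proof cases
    case 1
    then show ?thesis using x cd(1-3) g(2) by metis
  next
    case 2
    then show ?thesis using x cd(1-3) g(2) by metis
  qed
qed

end

section \<open>Disjoint unions of complete bipartite graphs and their components\<close>

text \<open>
  The two parts of the component \<open>H\<close> are \<open>S H True\<close> and \<open>S H False\<close>, so that a truth assignment
  to the components selects one part of each.
\<close>

locale complete_bipartite_union = graph G for G :: "('a, 'b) pre_digraph" +
  fixes Hs :: "('a, 'b) pre_digraph set" and S :: "('a, 'b) pre_digraph \<Rightarrow> bool \<Rightarrow> 'a set"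
  assumes members_subgraph: "H \<in> Hs \<Longrightarrow> subgraph H G"
    and members_bipartite: "H \<in> Hs \<Longrightarrow> complete_bipartite_on (S H True) (S H False) H"
    and members_disjoint: "pairwise (\<lambda>H K. verts H \<inter> verts K = {}) Hs"
    and is_Union: "G = pre_digraph.Union G Hs"
begin

lemma verts_conv: "verts G = (\<Union>H\<in>Hs. verts H)"
  by (subst is_Union) (simp add: Union_def)

lemma arcs_conv: "arcs G = (\<Union>H\<in>Hs. arcs H)"
  by (subst is_Union) (simp add: Union_def)

lemma part_nonempty: "H \<in> Hs \<Longrightarrow> S H b \<noteq> {}"
  using members_bipartite[of H] unfolding complete_bipartite_on_def by (cases b) auto

lemma mem_verts_member: "H \<in> Hs \<Longrightarrow> v \<in> verts H \<longleftrightarrow> (\<exists>b. v \<in> S H b)"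
  using members_bipartite[of H] unfolding complete_bipartite_on_def by (auto simp: ex_bool_eq)

lemma parts_eq:
  assumes "H \<in> Hs" "K \<in> Hs" "v \<in> S H b" "v \<in> S K d"
  shows "H = K" and "b = d"
proof -
  have "v \<in> verts H" "v \<in> verts K" using assms mem_verts_member by blast+
  then show "H = K" using members_disjoint assms(1,2) unfolding pairwise_def by blast
  then show "b = d"
    using assms members_bipartite[of H] unfolding complete_bipartite_on_def by (cases b; cases d) auto
qed

lemma adj_member:
  assumes "H \<in> Hs"
  shows "u \<rightarrow>\<^bsub>H\<^esub> v \<longleftrightarrow> (\<exists>b. u \<in> S H b \<and> v \<in> S H (\<not> b))"
  using members_bipartite[OF assms] unfolding complete_bipartite_on_def by (auto simp: ex_bool_eq)

lemma adj_conv: "u \<rightarrow>\<^bsub>G\<^esub> v \<longleftrightarrow> (\<exists>H\<in>Hs. u \<rightarrow>\<^bsub>H\<^esub> v)"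
proof -
  have "arc_to_ends H = arc_to_ends G" if "H \<in> Hs" for H
    using members_subgraph[OF that] unfolding subgraph_def compatible_def arc_to_ends_def by auto
  then show ?thesis unfolding arcs_ends_def arcs_conv by force
qed

lemma adj_iff: "u \<rightarrow>\<^bsub>G\<^esub> v \<longleftrightarrow> (\<exists>H\<in>Hs. \<exists>b. u \<in> S H b \<and> v \<in> S H (\<not> b))"
  by (simp add: adj_conv adj_member)

lemma reachable_in_member:
  assumes "u \<rightarrow>\<^sup>*\<^bsub>G\<^esub> v" and "H \<in> Hs" and "u \<in> verts H"
  shows "v \<in> verts H"
  using assms(1)
proof (induction rule: reachable_induct)
  case base
  then show ?case using assms(3) by simp
next
  case (step x y)
  then obtain K b where K: "K \<in> Hs" "x \<in> S K b" "y \<in> S K (\<not> b)" using adj_iff by blast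
  obtain d where "x \<in> S H d" using step.IH mem_verts_member assms(2) by blast
  then have "K = H" using parts_eq(1) K assms(2) by blast
  then show ?case using K mem_verts_member by blast
qed

text \<open>An arc with its tail in \<open>H\<close> belongs to some member containing that tail;
  disjointness makes this member \<open>H\<close>.\<close>

lemma member_induced:
  assumes H: "H \<in> Hs"
  shows "induced_subgraph H G"
proof
  show sub: "subgraph H G" by (rule members_subgraph[OF H])
  have "e \<in> arcs H" if e: "e \<in> arcs G" "tail G e \<in> verts H" for e
  proof -
    obtain K where K: "K \<in> Hs" "e \<in> arcs K" using e(1) arcs_conv by blast
    interpret K: wf_digraph K using members_subgraph[OF K(1)] by blast
    have "tail K = tail G"
      using members_subgraph[OF K(1)] unfolding subgraph_def compatible_def by simp
    then have "tail G e \<in> verts K" using K.tail_in_verts[OF K(2)] by simp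
    then have "K = H" using members_disjoint H K(1) e(2) unfolding pairwise_def by blast
    then show ?thesis using K(2) by simp
  qed
  moreover have "arcs H \<subseteq> arcs G" using sub by blast
  moreover have "tail G e \<in> verts H \<and> head G e \<in> verts H" if "e \<in> arcs H" for e
    using sub that wf_digraph.wellformed[of H e] unfolding subgraph_def compatible_def by auto
  ultimately show "arcs H = {e \<in> arcs G. tail G e \<in> verts H \<and> head G e \<in> verts H}" by blast
qed

lemma member_strongly_connected:
  assumes H: "H \<in> Hs"
  shows "strongly_connected H"
proof -
  interpret H: wf_digraph H using members_subgraph[OF H] by blast
  have "u \<rightarrow>\<^sup>*\<^bsub>H\<^esub> v" if uv: "u \<in> verts H" "v \<in> verts H" for u v
  proof -
    obtain b d where bd: "u \<in> S H b" "v \<in> S H d" using uv mem_verts_member[OF H] by blast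
    \<comment> \<open>A vertex of the opposite part is the midpoint of a walk between two vertices
      of the same part.\<close>
    obtain w where w: "w \<in> S H (\<not> b)" using part_nonempty[OF H] by blast
    show ?thesis
    proof (cases "b = d")
      case True
      have "u \<rightarrow>\<^bsub>H\<^esub> w" using bd w adj_member[OF H] by blast
      moreover have "w \<rightarrow>\<^bsub>H\<^esub> v"
        unfolding adj_member[OF H] using bd w True by (intro exI[of _ "\<not> b"]) simp
      ultimately show ?thesis by (meson H.reachable_adjI H.reachable_trans)
    next
      case False
      then have "d = (\<not> b)" by auto
      then have "u \<rightarrow>\<^bsub>H\<^esub> v" using bd adj_member[OF H] by blast
      then show ?thesis by (rule H.reachable_adjI)
    qed
  qed
  moreover have "verts H \<noteq> {}" using part_nonempty[OF H] mem_verts_member[OF H] by blast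
  ultimately show ?thesis unfolding strongly_connected_def by blast
qed

text \<open>Members are maximal because no walk leaves them. Conversely, a strong component meets
  some member, and strong components sharing a vertex coincide. This turns the number of components
  into the number of variables.\<close>

lemma sccs_eq: "sccs = Hs"
proof
  show sub: "Hs \<subseteq> sccs"
  proof
    fix H assume H: "H \<in> Hs"
    have "\<not> verts H \<subset> verts K" if K: "induced_subgraph K G" "strongly_connected K" for K
    proof
      assume "verts H \<subset> verts K"
      moreover obtain u where u: "u \<in> verts H"
        using member_strongly_connected[OF H] unfolding strongly_connected_def by blast
      ultimately obtain v where v: "v \<in> verts K" "v \<notin> verts H" "u \<in> verts K" by blast
      then have "u \<rightarrow>\<^sup>*\<^bsub>K\<^esub> v" using K(2) unfolding strongly_connected_def by blast
      then have "u \<rightarrow>\<^sup>*\<^bsub>G\<^esub> v" using K(1) reachable_mono induced_imp_subgraph by blast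
      then show False using reachable_in_member H u v(2) by blast
    qed
    then show "H \<in> sccs"
      by (intro in_sccsI member_induced[OF H] member_strongly_connected[OF H]) blast
  qed
  show "sccs \<subseteq> Hs"
  proof
    fix K assume K: "K \<in> sccs"
    then have "induced_subgraph K G" "verts K \<noteq> {}"
      unfolding sccs_def strongly_connected_def by simp_all
    moreover from this(1) have "verts K \<subseteq> verts G"
      by (intro subgraph_imp_subverts induced_imp_subgraph)
    ultimately obtain v where v: "v \<in> verts K" "v \<in> verts G" by blast
    then obtain H where H: "H \<in> Hs" "v \<in> verts H" using verts_conv by blast
    then have "H \<in> sccs" using sub by blast
    with K have "K = H" using scc_disj[of K H] v(1) H(2) by blast
    then show "K \<in> Hs" using H(1) by simp
  qed
qed

section \<open>Transversals as satisfying assignments\<close>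

definition literals :: "'a set \<Rightarrow> (('a, 'b) pre_digraph \<times> bool) set" where
  "literals V = {(H, b). H \<in> Hs \<and> V \<inter> S H b \<noteq> {}}"

text \<open>Pick in each block a vertex of a selected part. Adjacent vertices would lie in opposite
  parts of one component, but only one of these is selected.\<close>

lemma independent_transversal_if_satisfies:
  assumes "satisfies literals \<phi> P"
  shows "\<exists>T. independent_transversal G P T"
proof -
  have "\<forall>V\<in>P. \<exists>v. v \<in> V \<and> (\<exists>H\<in>Hs. v \<in> S H (\<phi> H))"
    using assms unfolding satisfies_def literals_def by blast
  from bchoice[OF this] obtain v
    where "\<forall>V\<in>P. v V \<in> V \<and> (\<exists>H\<in>Hs. v V \<in> S H (\<phi> H))" ..
  then have v: "\<And>V. V \<in> P \<Longrightarrow> v V \<in> V" "\<And>V. V \<in> P \<Longrightarrow> \<exists>H\<in>Hs. v V \<in> S H (\<phi> H)"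
    by simp_all
  have "v ` P \<subseteq> verts G" using v(2) mem_verts_member verts_conv by blast
  moreover have "\<not> v V \<rightarrow>\<^bsub>G\<^esub> v W" if VW: "V \<in> P" "W \<in> P" for V W
  proof
    assume "v V \<rightarrow>\<^bsub>G\<^esub> v W"
    then obtain H b where H: "H \<in> Hs" "v V \<in> S H b" "v W \<in> S H (\<not> b)" using adj_iff by blast
    obtain K where K: "K \<in> Hs" "v V \<in> S K (\<phi> K)" using v(2)[OF VW(1)] by blast
    obtain K' where K': "K' \<in> Hs" "v W \<in> S K' (\<phi> K')" using v(2)[OF VW(2)] by blast
    show False
      using parts_eq[OF H(1) K(1) H(2) K(2)] parts_eq[OF H(1) K'(1) H(3) K'(2)] by simp
  qed
  ultimately have "independent_transversal G P (v ` P)"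
    using v(1) unfolding independent_transversal_def independent_set_def
    by (intro conjI exI[of _ v]) auto
  then show ?thesis ..
qed

lemma satisfies_if_independent_transversal:
  assumes "independent_transversal (G \<restriction> X) Q T" and "X \<subseteq> verts G"
  shows "\<exists>\<phi>. satisfies literals \<phi> Q"
proof -
  obtain v where v: "\<forall>V\<in>Q. v V \<in> V" "T = v ` Q"
    using assms(1) unfolding independent_transversal_def by (elim conjE exE)
  have TX: "T \<subseteq> X"
    using assms(1) unfolding independent_transversal_def independent_set_def by simp
  have indep: "\<not> s \<rightarrow>\<^bsub>G \<restriction> X\<^esub> t" if "s \<in> T" "t \<in> T" for s t
    using assms(1) that unfolding independent_transversal_def independent_set_def by simp
  have nadj: "\<not> s \<rightarrow>\<^bsub>G\<^esub> t" if st: "s \<in> T" "t \<in> T" for s t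
  proof
    assume "s \<rightarrow>\<^bsub>G\<^esub> t"
    then obtain e where "e \<in> arcs G" "tail G e = s" "head G e = t" by (rule reachableE)
    then have "s \<rightarrow>\<^bsub>G \<restriction> X\<^esub> t"
      unfolding arcs_ends_conv using st TX by (intro image_eqI[of _ _ e]) auto
    then show False using indep st by blast
  qed
  \<comment> \<open>Components that \<open>T\<close> misses get the value false; this is harmless,
    since no block is represented there.\<close>
  define \<phi> where "\<phi> H \<longleftrightarrow> T \<inter> S H True \<noteq> {}" for H
  have "\<exists>H. (H, \<phi> H) \<in> literals V" if V: "V \<in> Q" for V
  proof -
    have vT: "v V \<in> T" using V v(2) by blast
    then have "v V \<in> verts G" using TX assms(2) by blast
    then obtain H b where H: "H \<in> Hs" "v V \<in> S H b" using verts_conv mem_verts_member by blast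
    have "\<phi> H = b"
    proof (cases b)
      case True
      then have "v V \<in> T \<inter> S H True" using H(2) vT by simp
      then show ?thesis using True unfolding \<phi>_def by blast
    next
      case False
      have "t \<rightarrow>\<^bsub>G\<^esub> v V" if "t \<in> S H True" for t
        \<comment> \<open>If \<open>T\<close> meets the false part of \<open>H\<close>, completeness
          and independence keep it out of the true part.\<close>
        unfolding adj_iff using that H False by (intro bexI[of _ H] exI[of _ True]) simp_all
      then have "T \<inter> S H True = {}" using nadj[OF _ vT] by blast
      then show ?thesis using False unfolding \<phi>_def by simp
    qed
    moreover have "v V \<in> V \<inter> S H b" using H(2) v(1) V by simp
    ultimately have "(H, \<phi> H) \<in> literals V" using H(1) unfolding literals_def by auto
    then show ?thesis ..
  qed
  then show ?thesis unfolding satisfies_def by blast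
qed

lemma vars_literals:
  assumes "partition_on (verts G) P"
  shows "vars literals P = Hs"
proof
  show "vars literals P \<subseteq> Hs" unfolding vars_def literals_def by auto
  show "Hs \<subseteq> vars literals P"
  proof
    fix H assume H: "H \<in> Hs"
    then obtain v where v: "v \<in> S H True" using part_nonempty by blast
    then have "v \<in> \<Union> P"
      using H verts_conv mem_verts_member partition_onD1[OF assms] by blast
    then have "\<exists>V\<in>P. (H, True) \<in> literals V" using H v unfolding literals_def by blast
    then show "H \<in> vars literals P" unfolding vars_def by force
  qed
qed

end

theorem theorem16:
  fixes G :: "('a, 'b) pre_digraph" and P :: "'a set set" and r :: nat
  assumes "graph G"
    and "partition_on (verts G) P"
    and "card P = r"
    and "r \<ge> 2"
    and "block_minimal_no_IT G P"
    and "disjoint_union_of_complete_bipartite G"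
    and "card (pre_digraph.sccs G) = r - 1"
  shows "\<exists>H \<in> pre_digraph.sccs G. \<exists>A B. complete_bipartite_on A B H \<and>
           (\<exists>Vi \<in> P. \<exists>Vj \<in> P. Vi \<noteq> Vj \<and> A \<subseteq> Vi \<and> B \<subseteq> Vj)"
proof -
  obtain Hs where Hs: "\<And>H. H \<in> Hs \<Longrightarrow> subgraph H G"
      "\<And>H. H \<in> Hs \<Longrightarrow> \<exists>A B. complete_bipartite_on A B H"
      "pairwise (\<lambda>H K. verts H \<inter> verts K = {}) Hs" "G = pre_digraph.Union G Hs"
    using assms(6) unfolding disjoint_union_of_complete_bipartite_def by blast
  obtain A B where AB: "\<And>H. H \<in> Hs \<Longrightarrow> complete_bipartite_on (A H) (B H) H"
    using Hs(2) by metis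
  define S where "S H b = (if b then A H else B H)" for H b
  interpret graph G by (rule assms(1))
  interpret complete_bipartite_union G Hs S
    using Hs(1,3,4) AB by unfold_locales (simp_all only: S_def if_True if_False)
  have "card Hs = r - 1" using assms(7) sccs_eq by simp
  \<comment> \<open>From \<open>r \<ge> 2\<close> there is at least one component; positive
    cardinality also yields finiteness of \<open>Hs\<close> and \<open>P\<close>.\<close>
  then have cardHs: "card Hs > 0" "card P = card Hs + 1" using assms(3,4) by auto
  then have finHs: "finite Hs" by (simp add: card_gt_0_iff)
  interpret minimally_unsatisfiable_1 literals P
  proof unfold_locales
    show "finite P" using cardHs(2) by (intro card_ge_0_finite) simp
    show "finite (literals V)" for V
      by (rule finite_subset[of _ "Hs \<times> UNIV"]) (auto simp: literals_def finHs)
    show "\<not> satisfies literals \<phi> P" for \<phi>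
      using assms(5) independent_transversal_if_satisfies[of \<phi> P]
      unfolding block_minimal_no_IT_def by auto
    show "\<exists>\<phi>. satisfies literals \<phi> (P - {V})" if V: "V \<in> P" for V
    proof -
      obtain T where "independent_transversal (G \<restriction> (verts G - V)) (P - {V}) T"
        using assms(5) V unfolding block_minimal_no_IT_def by blast
      then show ?thesis by (rule satisfies_if_independent_transversal) (rule Diff_subset)
    qed
    show "card P = card (vars literals P) + 1" "vars literals P \<noteq> {}"
      using cardHs vars_literals[OF assms(2)] by auto
  qed
  obtain H V W where HVW: "H \<in> Hs" "V \<in> P" "W \<in> P" "V \<noteq> W"
      "\<forall>X\<in>P. (H, True) \<in> literals X \<longrightarrow> X = V"
      "\<forall>X\<in>P. (H, False) \<in> literals X \<longrightarrow> X = W"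
    using variable_occurring_once_each unfolding vars_literals[OF assms(2)] by blast
  \<comment> \<open>Every vertex of the part lies in some block, and that block then contains the
    literal \<open>(H, b)\<close>, so it can only be \<open>Y\<close>.\<close>
  have part_sub: "S H b \<subseteq> Y" if Y: "\<forall>X\<in>P. (H, b) \<in> literals X \<longrightarrow> X = Y" for b Y
  proof
    fix v assume v: "v \<in> S H b"
    then have "v \<in> \<Union> P"
      using HVW(1) verts_conv mem_verts_member partition_onD1[OF assms(2)] by blast
    then obtain X where X: "X \<in> P" "v \<in> X" by blast
    then have "(H, b) \<in> literals X" using v HVW(1) unfolding literals_def by blast
    then show "v \<in> Y" using Y X by blast
  qed
  have "S H True \<subseteq> V" "S H False \<subseteq> W" using part_sub[OF HVW(5)] part_sub[OF HVW(6)] by simp_all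
  with members_bipartite[OF HVW(1)] HVW(2-4) have "\<exists>A B. complete_bipartite_on A B H \<and>
      (\<exists>Vi\<in>P. \<exists>Vj\<in>P. Vi \<noteq> Vj \<and> A \<subseteq> Vi \<and> B \<subseteq> Vj)" by blast
  then show ?thesis using HVW(1) sccs_eq by blast
qed

end
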